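(* Let $X$ be a real Banach space, let $G$ be an amenable discrete group, and let $V\colon G\to\operatorname{Isom}_{\mathrm{lin}}(X)$, $g\mapsto V_g$, be a representation by surjective linear isometries. Set $\mathcal D_V=\overline{\operatorname{span}}\{V_gu-u:g\in G,\ u\in X\}$. Then there exists a linear isometric embedding $$J_V\colon X/\mathcal D_V\longrightarrow X^{**}.$$ Moreover, the subspace $$\mathcal D_V^\perp=\{f\in X^*: V_g^*f=f\text{ for every }g\in G\}$$ is the range of a contractive projection on $X^*$.
   Context: $\operatorname{Isom}_{\mathrm{lin}}(X)$ is the group of surjective linear isometries of $X$; a representation is a group homomorphism into it. A discrete group $G$ is amenable if $\ell_\infty(G)$ (all bounded real functions on $G$, supremum norm) carries an invariant mean. $\mathcal D_V^\perp\subseteq X^*$ denotes the annihilator of $\mathcal D_V$. Contractive means of norm at most one. *)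

theory Defs
  imports "HOL-Analysis.Analysis" "HOL-Algebra.Group"
begin

section \<open>Surjective linear isometries and representations\<close>

definition Isom_lin :: "('a::real_normed_vector \<Rightarrow>\<^sub>L 'a) monoid" where
  "Isom_lin =
    \<lparr>carrier = {T. (\<forall>x. norm (blinfun_apply T x) = norm x) \<and> surj (blinfun_apply T)},
     mult = (o\<^sub>L),
     one = id_blinfun\<rparr>"

lemma group_Isom_lin: "group (Isom_lin :: ('a::real_normed_vector \<Rightarrow>\<^sub>L 'a) monoid)"
proof (rule groupI)
  fix S T :: "'a \<Rightarrow>\<^sub>L 'a"
  assume "S \<in> carrier Isom_lin" "T \<in> carrier Isom_lin"
  then show "S \<otimes>\<^bsub>Isom_lin\<^esub> T \<in> carrier Isom_lin"
    using comp_surj[of "blinfun_apply T" "blinfun_apply S"]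
    by (auto simp: Isom_lin_def comp_def)
next
  fix T :: "'a \<Rightarrow>\<^sub>L 'a"
  assume "T \<in> carrier Isom_lin"
  then have iso: "\<And>x. norm (T x) = norm x" and sur: "surj (blinfun_apply T)"
    by (auto simp: Isom_lin_def)
  have inj: "inj (blinfun_apply T)"
  proof (rule injI)
    fix x y assume "T x = T y"
    then have "norm (T (x - y)) = 0" by (simp add: blinfun.diff_right)
    then show "x = y" using iso[of "x - y"] by simp
  qed
  define S where "S = inv_into UNIV (blinfun_apply T)"
  have TS: "T (S y) = y" for y unfolding S_def by (rule surj_f_inv_f[OF sur])
  have ST: "S (T x) = x" for x unfolding S_def by (rule inv_f_f[OF inj])
  have "bounded_linear S"
  proof (rule bounded_linear_intro[where K = 1])
    show "S (x + y) = S x + S y" for x y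
      by (rule injD[OF inj]) (simp add: TS blinfun.add_right)
    show "S (r *\<^sub>R x) = r *\<^sub>R S x" for r x
      by (rule injD[OF inj]) (simp add: TS blinfun.scaleR_right)
    show "norm (S x) \<le> norm x * 1" for x
      using iso[of "S x"] by (simp add: TS)
  qed
  then have S: "blinfun_apply (Blinfun S) = S" by (rule bounded_linear_Blinfun_apply)
  have "norm (S x) = norm x" for x using iso[of "S x"] by (simp add: TS)
  moreover have "surj S" using ST by (metis surjI)
  ultimately have "Blinfun S \<in> carrier Isom_lin" by (simp add: Isom_lin_def S)
  moreover have "Blinfun S \<otimes>\<^bsub>Isom_lin\<^esub> T = \<one>\<^bsub>Isom_lin\<^esub>"
    by (auto simp: Isom_lin_def S ST intro!: blinfun_eqI)
  ultimately show "\<exists>S\<in>carrier Isom_lin. S \<otimes>\<^bsub>Isom_lin\<^esub> T = \<one>\<^bsub>Isom_lin\<^esub>" by blast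
qed (auto simp: Isom_lin_def intro!: blinfun_eqI)

section \<open>Amenability of discrete groups\<close>

text \<open>Functions on the group are represented by the functions on the element type that are
  \<open>undefined\<close> outside the carrier.\<close>

definition linfty :: "('g, 'm) monoid_scheme \<Rightarrow> ('g \<Rightarrow> real) set" where
  "linfty G = {f \<in> extensional (carrier G). bounded (f ` carrier G)}"

definition linfty_norm :: "('g, 'm) monoid_scheme \<Rightarrow> ('g \<Rightarrow> real) \<Rightarrow> real" where
  "linfty_norm G f = (SUP x\<in>carrier G. \<bar>f x\<bar>)"

text \<open>A mean is a linear functional \<open>m\<close> with \<open>\<parallel>m\<parallel> = m(1) = 1\<close>; given \<open>m(1) = 1\<close>, the norm
  condition amounts to \<open>\<parallel>m\<parallel> \<le> 1\<close>.\<close>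

definition is_mean :: "('g, 'm) monoid_scheme \<Rightarrow> (('g \<Rightarrow> real) \<Rightarrow> real) \<Rightarrow> bool" where
  "is_mean G m \<longleftrightarrow>
    (\<forall>f\<in>linfty G. \<forall>h\<in>linfty G. m (\<lambda>x\<in>carrier G. f x + h x) = m f + m h) \<and>
    (\<forall>c. \<forall>f\<in>linfty G. m (\<lambda>x\<in>carrier G. c * f x) = c * m f) \<and>
    (\<forall>f\<in>linfty G. \<bar>m f\<bar> \<le> linfty_norm G f) \<and>
    m (\<lambda>x\<in>carrier G. 1) = 1"

definition left_invariant :: "('g, 'm) monoid_scheme \<Rightarrow> (('g \<Rightarrow> real) \<Rightarrow> real) \<Rightarrow> bool" where
  "left_invariant G m \<longleftrightarrow>
    (\<forall>g\<in>carrier G. \<forall>f\<in>linfty G. m (\<lambda>x\<in>carrier G. f (g \<otimes>\<^bsub>G\<^esub> x)) = m f)"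

definition amenable :: "('g, 'm) monoid_scheme \<Rightarrow> bool" where
  "amenable G \<longleftrightarrow> (\<exists>m. is_mean G m \<and> left_invariant G m)"

section \<open>Quotient of a normed space by a subspace\<close>

definition coset :: "'a::real_normed_vector set \<Rightarrow> 'a \<Rightarrow> 'a set" where
  "coset D x = {x + d |d. d \<in> D}"

definition quot_space :: "'a::real_normed_vector set \<Rightarrow> 'a set set" where
  "quot_space D = range (coset D)"

definition quot_add :: "'a::real_normed_vector set \<Rightarrow> 'a set \<Rightarrow> 'a set" where
  "quot_add A B = {a + b |a b. a \<in> A \<and> b \<in> B}"

text \<open>The summand from \<open>D\<close> matters only for \<open>c = 0\<close>, where the result has to be the zero class \<open>D\<close>
  rather than \<open>{0}\<close>.\<close>

definition quot_scale :: "'a::real_normed_vector set \<Rightarrow> real \<Rightarrow> 'a set \<Rightarrow> 'a set" where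
  "quot_scale D c A = {c *\<^sub>R a + d |a d. a \<in> A \<and> d \<in> D}"

definition quot_norm :: "'a::real_normed_vector set \<Rightarrow> real" where
  "quot_norm A = (INF a\<in>A. norm a)"

lemma quot_add_coset:
  assumes "subspace D"
  shows "quot_add (coset D x) (coset D y) = coset D (x + y)"
proof -
  have "\<exists>a b. x + y + d = a + b \<and> (\<exists>d. a = x + d \<and> d \<in> D) \<and> (\<exists>d. b = y + d \<and> d \<in> D)"
    if "d \<in> D" for d
    using that subspace_0[OF assms]
    by (intro exI[of _ "x + d"] exI[of _ "y + 0"]) (auto simp: algebra_simps)
  moreover have "\<exists>d. x + d1 + (y + d2) = x + y + d \<and> d \<in> D" if "d1 \<in> D" "d2 \<in> D" for d1 d2
    using that subspace_add[OF assms]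
    by (intro exI[of _ "d1 + d2"]) (auto simp: algebra_simps)
  ultimately show ?thesis
    unfolding quot_add_def coset_def by blast
qed

lemma quot_scale_coset:
  assumes "subspace D"
  shows "quot_scale D c (coset D x) = coset D (c *\<^sub>R x)"
proof -
  have "\<exists>a d'. c *\<^sub>R x + d = c *\<^sub>R a + d' \<and> (\<exists>d. a = x + d \<and> d \<in> D) \<and> d' \<in> D" if "d \<in> D" for d
    using that subspace_0[OF assms] by (intro exI[of _ "x + 0"] exI[of _ d]) auto
  moreover have "\<exists>d. c *\<^sub>R (x + d1) + d2 = c *\<^sub>R x + d \<and> d \<in> D" if "d1 \<in> D" "d2 \<in> D" for d1 d2
    using that subspace_add[OF assms] subspace_scale[OF assms]
    by (intro exI[of _ "c *\<^sub>R d1 + d2"]) (auto simp: algebra_simps)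
  ultimately show ?thesis
    unfolding quot_scale_def coset_def by blast
qed

definition quot_linear_isometric_embedding ::
    "'a::real_normed_vector set \<Rightarrow> ('a set \<Rightarrow> 'b::real_normed_vector) \<Rightarrow> bool" where
  "quot_linear_isometric_embedding D J \<longleftrightarrow>
    (\<forall>A\<in>quot_space D. \<forall>B\<in>quot_space D. J (quot_add A B) = J A + J B) \<and>
    (\<forall>c. \<forall>A\<in>quot_space D. J (quot_scale D c A) = c *\<^sub>R J A) \<and>
    (\<forall>A\<in>quot_space D. norm (J A) = quot_norm A)"

section \<open>Annihilators, adjoints, contractive projections\<close>

definition annihilator :: "'a::real_normed_vector set \<Rightarrow> ('a \<Rightarrow>\<^sub>L real) set" where
  "annihilator D = {f. \<forall>x\<in>D. blinfun_apply f x = 0}"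

definition adjoint_op ::
    "('a::real_normed_vector \<Rightarrow>\<^sub>L 'b::real_normed_vector) \<Rightarrow> ('b \<Rightarrow>\<^sub>L real) \<Rightarrow> ('a \<Rightarrow>\<^sub>L real)" where
  "adjoint_op T f = f o\<^sub>L T"

definition contractive_projection :: "('b::real_normed_vector \<Rightarrow>\<^sub>L 'b) \<Rightarrow> bool" where
  "contractive_projection P \<longleftrightarrow> P o\<^sub>L P = P \<and> norm P \<le> 1"

section \<open>The closed span of the coboundaries\<close>

definition cobound_space ::
    "('g, 'm) monoid_scheme \<Rightarrow> ('g \<Rightarrow> 'a::real_normed_vector \<Rightarrow>\<^sub>L 'a) \<Rightarrow> 'a set" where
  "cobound_space G V = closure (span {blinfun_apply (V g) u - u |g u. g \<in> carrier G})"

lemma subspace_cobound_space: "subspace (cobound_space G V)"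
proof -
  let ?S = "span {blinfun_apply (V g) u - u |g u. g \<in> carrier G}"
  have "x + y \<in> closure ?S" if "x \<in> closure ?S" "y \<in> closure ?S" for x y
    using that unfolding closure_sequential
    by (metis (no_types, lifting) span_add tendsto_add)
  moreover have "c *\<^sub>R x \<in> closure ?S" if "x \<in> closure ?S" for c x
    using that unfolding closure_sequential
    by (metis (no_types, lifting) span_scale tendsto_scaleR tendsto_const)
  moreover have "0 \<in> closure ?S"
    using closure_subset span_zero by blast
  ultimately show ?thesis
    unfolding cobound_space_def subspace_def by blast
qed

end

theory Submission
  imports Defs
begin

text \<open>
  Averaging the functions \<open>g \<mapsto> f (V\<^bsub>g\<inverse>\<^esub> x)\<close> with an invariant mean turns every functional \<open>f\<close>
  into a \<open>V\<close>-invariant functional \<open>P f\<close>. The mean has norm one and the \<open>V\<^sub>g\<close> are isometries, so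
  \<open>P\<close> is contractive; it fixes invariant functionals because the mean of a constant function is
  that constant (\<open>invariant_contractive_projection\<close>). The invariant functionals are exactly those
  vanishing on every \<open>V\<^sub>g u - u\<close>, hence, by continuity, on the whole space \<open>\<D>\<^sub>V\<close>
  (\<open>annihilator_cobound_space\<close>).

  The embedding is then \<open>x + D \<mapsto> (f \<mapsto> (P f) x)\<close>. Since \<open>P f\<close> annihilates \<open>D = \<D>\<^sub>V\<close>, the value
  depends on the coset only, and contractivity of \<open>P\<close> bounds its norm by the quotient norm. The
  bound is attained at a functional \<open>f\<close> of norm at most one that annihilates \<open>D\<close> and takes
  the value \<open>\<parallel>x + D\<parallel>\<close> at \<open>x\<close>, because \<open>P\<close> fixes this \<open>f\<close>.

  Such an \<open>f\<close> comes from the Hahn--Banach theorem (\<open>hahn_banach_support\<close>). It is proved here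
  by applying Zorn's lemma to sublinear functionals on the whole space instead of to
  partially defined linear ones: a minimal sublinear functional is linear.
\<close>

section \<open>Sublinear functionals and the Hahn--Banach theorem\<close>

definition sublinear :: "('a::real_vector \<Rightarrow> real) \<Rightarrow> bool" where
  "sublinear p \<longleftrightarrow> (\<forall>x y. p (x + y) \<le> p x + p y) \<and> (\<forall>c\<ge>0. \<forall>x. p (c *\<^sub>R x) = c * p x)"

lemma sublinear_add: "sublinear p \<Longrightarrow> p (x + y) \<le> p x + p y"
  and sublinear_scale: "sublinear p \<Longrightarrow> c \<ge> 0 \<Longrightarrow> p (c *\<^sub>R x) = c * p x"
  by (auto simp: sublinear_def)

lemma sublinear_0: "sublinear p \<Longrightarrow> p 0 = 0"
  using sublinear_scale[of p 0 0] by simp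

lemma sublinear_uminus_ge: "sublinear p \<Longrightarrow> - p (- x) \<le> p x"
  using sublinear_add[of p x "- x"] sublinear_0[of p] by simp

text \<open>One inequality suffices for homogeneity: apply it also to \<open>1 / c\<close>.\<close>

lemma sublinearI:
  assumes zero: "p 0 = 0"
    and add: "\<And>x y. p (x + y) \<le> p x + p y"
    and scale: "\<And>c x. c > 0 \<Longrightarrow> p (c *\<^sub>R x) \<le> c * p x"
  shows "sublinear p"
proof -
  have "p (c *\<^sub>R x) = c * p x" if "c \<ge> 0" for c x
  proof (cases "c = 0")
    case False
    with that have "c > 0" by simp
    have "p x \<le> (1 / c) * p (c *\<^sub>R x)"
      using scale[of "1 / c" "c *\<^sub>R x"] \<open>c > 0\<close> by simp
    then have "c * p x \<le> p (c *\<^sub>R x)"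
      using \<open>c > 0\<close> by (simp add: field_simps)
    with scale[OF \<open>c > 0\<close>] show ?thesis by (simp add: antisym)
  qed (simp add: zero)
  with add show ?thesis by (simp add: sublinear_def)
qed

text \<open>The largest sublinear functional below \<open>p\<close> whose value at \<open>- x\<close> is at most \<open>- p x\<close>.
  A linear functional \<open>f \<le> p\<close> satisfies \<open>f x = p x\<close> if and only if it lies below \<open>tilt p x\<close>.\<close>

definition tilt :: "('a::real_vector \<Rightarrow> real) \<Rightarrow> 'a \<Rightarrow> 'a \<Rightarrow> real" where
  "tilt p x y = (INF t\<in>{0..}. p (y + t *\<^sub>R x) - t * p x)"

lemma tilt_lower:
  assumes "sublinear p" "t \<ge> 0"
  shows "- p (- y) \<le> p (y + t *\<^sub>R x) - t * p x"
  using sublinear_add[OF assms(1), of "y + t *\<^sub>R x" "- y"] sublinear_scale[OF assms, of x]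
  by simp

lemma tilt_le:
  assumes "sublinear p" "t \<ge> 0"
  shows "tilt p x y \<le> p (y + t *\<^sub>R x) - t * p x"
  unfolding tilt_def
proof (rule cINF_lower)
  show "bdd_below ((\<lambda>t. p (y + t *\<^sub>R x) - t * p x) ` {0..})"
    by (rule bdd_belowI2[where m = "- p (- y)"]) (simp add: tilt_lower assms)
qed (use assms in simp)

lemma tilt_ge:
  assumes "\<And>t. t \<ge> 0 \<Longrightarrow> b \<le> p (y + t *\<^sub>R x) - t * p x"
  shows "b \<le> tilt p x y"
  unfolding tilt_def by (rule cINF_greatest) (use assms in auto)

lemma tilt_le_self: "sublinear p \<Longrightarrow> tilt p x y \<le> p y"
  using tilt_le[of p 0 x y] by simp

lemma tilt_uminus: "sublinear p \<Longrightarrow> tilt p x (- x) \<le> - p x"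
  using tilt_le[of p 1 x "- x"] sublinear_0[of p] by simp

lemma sublinear_tilt:
  assumes p: "sublinear p"
  shows "sublinear (tilt p x)"
proof (rule sublinearI)
  have "0 \<le> tilt p x 0"
    by (rule tilt_ge) (use tilt_lower[OF p, of _ 0 x] sublinear_0[OF p] in simp)
  with tilt_le_self[OF p, of x 0] sublinear_0[OF p] show "tilt p x 0 = 0"
    by simp
next
  fix y z
  have "tilt p x (y + z) \<le> (p (y + s *\<^sub>R x) - s * p x) + (p (z + t *\<^sub>R x) - t * p x)"
    if "s \<ge> 0" "t \<ge> 0" for s t
    using tilt_le[OF p, of "s + t" x "y + z"] that
      sublinear_add[OF p, of "y + s *\<^sub>R x" "z + t *\<^sub>R x"]
    by (simp add: algebra_simps)
  then have "tilt p x (y + z) - (p (z + t *\<^sub>R x) - t * p x) \<le> tilt p x y" if "t \<ge> 0" for t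
    by (intro tilt_ge) (use that in \<open>simp add: diff_le_eq\<close>)
  then have "tilt p x (y + z) - tilt p x y \<le> tilt p x z"
    by (intro tilt_ge) (simp add: algebra_simps)
  then show "tilt p x (y + z) \<le> tilt p x y + tilt p x z" by simp
next
  fix c :: real and y
  assume c: "c > 0"
  have "tilt p x (c *\<^sub>R y) / c \<le> tilt p x y"
  proof (rule tilt_ge)
    fix t :: real
    assume "t \<ge> 0"
    then have "tilt p x (c *\<^sub>R y) \<le> p (c *\<^sub>R (y + t *\<^sub>R x)) - (c * t) * p x"
      using tilt_le[OF p, of "c * t" x "c *\<^sub>R y"] c by (simp add: scaleR_right_distrib)
    also have "\<dots> = c * (p (y + t *\<^sub>R x) - t * p x)"
      using sublinear_scale[OF p, of c "y + t *\<^sub>R x"] c by (simp add: algebra_simps)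
    finally show "tilt p x (c *\<^sub>R y) / c \<le> p (y + t *\<^sub>R x) - t * p x"
      using c by (simp add: divide_le_eq mult.commute)
  qed
  then show "tilt p x (c *\<^sub>R y) \<le> c * tilt p x y"
    using c by (simp add: divide_le_eq mult.commute)
qed

text \<open>Minimality forces \<open>q = tilt q x\<close> for every \<open>x\<close>, so \<open>q\<close> is odd, and an odd subadditive
  functional is additive.\<close>

lemma minimal_sublinear_linear:
  assumes q: "sublinear q"
    and minimal: "\<And>r. sublinear r \<Longrightarrow> (\<And>y. r y \<le> q y) \<Longrightarrow> r = q"
  shows "linear q"
proof -
  have odd: "q (- x) = - q x" for x
  proof -
    have "tilt q x = q"
      by (rule minimal[OF sublinear_tilt[OF q] tilt_le_self[OF q]])
    with tilt_uminus[OF q, of x] sublinear_uminus_ge[OF q, of x] show ?thesis by simp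
  qed
  show ?thesis
  proof (rule linearI)
    fix x y
    show "q (x + y) = q x + q y"
      using sublinear_add[OF q, of x y] sublinear_add[OF q, of "- x" "- y"] odd[of "x + y"]
      by (simp add: odd)
  next
    fix c x
    show "q (c *\<^sub>R x) = c *\<^sub>R q x"
    proof (cases "c \<ge> 0")
      case True
      then show ?thesis using sublinear_scale[OF q] by simp
    next
      case False
      then have "q (- (c *\<^sub>R x)) = - c * q x"
        using sublinear_scale[OF q, of "- c" x] by simp
      with odd[of "c *\<^sub>R x"] show ?thesis by simp
    qed
  qed
qed

text \<open>Along a chain, the pointwise infimum is finite because each \<open>q \<le> p\<close> satisfies
  \<open>q y \<ge> - q (- y) \<ge> - p (- y)\<close>.\<close>

lemma sublinear_Inf_chain:
  assumes "C \<noteq> {}"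
    and sub: "\<And>q. q \<in> C \<Longrightarrow> sublinear q"
    and le: "\<And>q. q \<in> C \<Longrightarrow> q \<le> p"
    and chain: "\<And>q r. q \<in> C \<Longrightarrow> r \<in> C \<Longrightarrow> q \<le> r \<or> r \<le> q"
  shows "sublinear (\<lambda>y. INF q\<in>C. q y)" (is "sublinear ?I")
    and "\<And>q y. q \<in> C \<Longrightarrow> (INF q\<in>C. q y) \<le> q y"
proof -
  have "- p (- y) \<le> q y" if "q \<in> C" for q y
    using sublinear_uminus_ge[OF sub[OF that], of y] le_funD[OF le[OF that], of "- y"] by simp
  then have "bdd_below ((\<lambda>q. q y) ` C)" for y
    by (intro bdd_belowI2[where m = "- p (- y)"])
  then show lower: "?I y \<le> q y" if "q \<in> C" for q y
    by (intro cINF_lower that)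
  show "sublinear ?I"
  proof (rule sublinearI)
    show "?I 0 = 0"
      using \<open>C \<noteq> {}\<close> sub by (simp add: sublinear_0 cong: INF_cong_simp)
  next
    fix x y
    have "?I (x + y) \<le> q x + r y" if "q \<in> C" "r \<in> C" for q r
    proof -
      obtain s where "s \<in> C" "s \<le> q" "s \<le> r"
        using chain[OF \<open>q \<in> C\<close> \<open>r \<in> C\<close>] \<open>q \<in> C\<close> \<open>r \<in> C\<close> order_refl by metis
      then show ?thesis
        using lower[of s "x + y"] sublinear_add[OF sub[of s], of x y]
          le_funD[of s q x] le_funD[of s r y]
        by simp
    qed
    then have "?I (x + y) - r y \<le> ?I x" if "r \<in> C" for r
      by (intro cINF_greatest) (use that \<open>C \<noteq> {}\<close> in \<open>auto simp: diff_le_eq\<close>)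
    then have "?I (x + y) - ?I x \<le> ?I y"
      by (intro cINF_greatest) (use \<open>C \<noteq> {}\<close> in \<open>auto simp: algebra_simps\<close>)
    then show "?I (x + y) \<le> ?I x + ?I y" by simp
  next
    fix c :: real and x
    assume c: "c > 0"
    have "?I (c *\<^sub>R x) / c \<le> ?I x"
    proof (rule cINF_greatest[OF \<open>C \<noteq> {}\<close>])
      fix q
      assume "q \<in> C"
      with lower[of q "c *\<^sub>R x"] sublinear_scale[OF sub, of q c x] c
      show "?I (c *\<^sub>R x) / c \<le> q x" by (simp add: divide_le_eq mult.commute)
    qed
    then show "?I (c *\<^sub>R x) \<le> c * ?I x"
      using c by (simp add: divide_le_eq mult.commute)
  qed
qed

lemma exists_linear_below:
  assumes p: "sublinear p"
  obtains q where "linear q" "q \<le> p"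
proof -
  define A where "A = {q. sublinear q \<and> q \<le> p}"
  have "\<exists>q\<in>A. \<forall>r\<in>A. r \<le> q \<longrightarrow> r = q"
  proof (rule predicate_Zorn)
    show "partial_order_on A (relation_of (\<lambda>q r. r \<le> q) A)"
      by (rule partial_order_on_relation_ofI) auto
  next
    fix C
    assume "C \<in> Chains (relation_of (\<lambda>q r. r \<le> q) A)"
    then have chain: "\<And>q r. q \<in> C \<Longrightarrow> r \<in> C \<Longrightarrow> q \<le> r \<or> r \<le> q" and "C \<subseteq> A"
      by (auto simp: Chains_def relation_of_def)
    show "\<exists>u\<in>A. \<forall>q\<in>C. u \<le> q"
    proof (cases "C = {}")
      case True
      then show ?thesis using p by (auto simp: A_def)
    next
      case False
      have sub: "\<And>q. q \<in> C \<Longrightarrow> sublinear q" and le: "\<And>q. q \<in> C \<Longrightarrow> q \<le> p"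
        using \<open>C \<subseteq> A\<close> by (auto simp: A_def)
      let ?I = "\<lambda>y. INF q\<in>C. q y"
      have I: "sublinear ?I" and lower: "\<And>q. q \<in> C \<Longrightarrow> ?I \<le> q"
        using sublinear_Inf_chain[OF False sub le chain] by (auto simp: le_fun_def)
      moreover obtain q where "q \<in> C" using False by blast
      ultimately have "?I \<in> A"
        using order_trans[OF lower[of q] le[of q]] by (simp add: A_def)
      with lower show ?thesis by blast
    qed
  qed
  then obtain q where "q \<in> A" and minimal: "\<And>r. r \<in> A \<Longrightarrow> r \<le> q \<Longrightarrow> r = q"
    by blast
  have "r = q" if "sublinear r" "\<And>y. r y \<le> q y" for r
  proof (rule minimal)
    show "r \<le> q" using that(2) by (simp add: le_fun_def)
    with that(1) \<open>q \<in> A\<close> show "r \<in> A" using order_trans[of r q p] by (simp add: A_def)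
  qed
  then have "linear q"
    using minimal_sublinear_linear \<open>q \<in> A\<close> by (auto simp: A_def)
  with that \<open>q \<in> A\<close> show thesis by (auto simp: A_def)
qed

text \<open>A linear functional below \<open>tilt p x\<close> is at most \<open>- p x\<close> at \<open>- x\<close>, hence at least \<open>p x\<close> at \<open>x\<close>.\<close>

lemma hahn_banach_support:
  assumes p: "sublinear p"
  obtains f where "linear f" "\<And>y. f y \<le> p y" "f x = p x"
proof -
  obtain f where f: "linear f" and le: "f \<le> tilt p x"
    using exists_linear_below[OF sublinear_tilt[OF p]] .
  have below: "f y \<le> p y" for y
    using le_funD[OF le, of y] tilt_le_self[OF p, of x y] by simp
  have "- f x \<le> - p x"
    using le_funD[OF le, of "- x"] tilt_uminus[OF p, of x] linear_neg[OF f, of x] by simp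
  with below[of x] have "f x = p x" by simp
  with that f below show thesis by blast
qed

section \<open>The quotient norm and norming functionals\<close>

lemma quot_norm_coset_le:
  assumes "d \<in> D"
  shows "quot_norm (coset D x) \<le> norm (x + d)"
  unfolding quot_norm_def
proof (rule cINF_lower)
  show "bdd_below (norm ` coset D x)" by (rule bdd_belowI2[where m = 0]) simp
qed (use assms in \<open>auto simp: coset_def\<close>)

lemma quot_norm_coset_ge:
  assumes "subspace D" "\<And>d. d \<in> D \<Longrightarrow> b \<le> norm (x + d)"
  shows "b \<le> quot_norm (coset D x)"
  unfolding quot_norm_def
  by (rule cINF_greatest) (use assms subspace_0[OF assms(1)] in \<open>auto simp: coset_def\<close>)

lemma quot_norm_coset_le_norm: "subspace D \<Longrightarrow> quot_norm (coset D x) \<le> norm x"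
  using quot_norm_coset_le[of 0 D x] subspace_0[of D] by simp

lemma quot_norm_coset_mem:
  assumes D: "subspace D" and "d \<in> D"
  shows "quot_norm (coset D d) = 0"
proof (rule antisym)
  show "quot_norm (coset D d) \<le> 0"
    using quot_norm_coset_le[of "- d" D d] subspace_neg[OF assms] by simp
  show "0 \<le> quot_norm (coset D d)" by (rule quot_norm_coset_ge[OF D]) simp
qed

lemma sublinear_quot_norm:
  assumes D: "subspace D"
  shows "sublinear (\<lambda>x. quot_norm (coset D x))"
proof (rule sublinearI)
  show "quot_norm (coset D 0) = 0"
    by (rule quot_norm_coset_mem[OF D subspace_0[OF D]])
next
  fix x y
  let ?q = "\<lambda>x. quot_norm (coset D x)"
  have "?q (x + y) \<le> norm (x + d) + norm (y + e)" if "d \<in> D" "e \<in> D" for d e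
    using quot_norm_coset_le[OF subspace_add[OF D that], of "x + y"]
      norm_triangle_ineq[of "x + d" "y + e"]
    by (simp add: algebra_simps)
  then have "?q (x + y) - norm (y + e) \<le> ?q x" if "e \<in> D" for e
    by (intro quot_norm_coset_ge[OF D]) (use that in \<open>simp add: diff_le_eq\<close>)
  then have "?q (x + y) - ?q x \<le> ?q y"
    by (intro quot_norm_coset_ge[OF D]) (simp add: algebra_simps)
  then show "?q (x + y) \<le> ?q x + ?q y" by simp
next
  fix c :: real and x
  assume c: "c > 0"
  have "quot_norm (coset D (c *\<^sub>R x)) / c \<le> quot_norm (coset D x)"
  proof (rule quot_norm_coset_ge[OF D])
    fix d
    assume "d \<in> D"
    then have "quot_norm (coset D (c *\<^sub>R x)) \<le> norm (c *\<^sub>R (x + d))"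
      using quot_norm_coset_le[OF subspace_scale[OF D \<open>d \<in> D\<close>, of c], of "c *\<^sub>R x"]
      by (simp add: scaleR_right_distrib)
    then show "quot_norm (coset D (c *\<^sub>R x)) / c \<le> norm (x + d)"
      using c by (simp add: divide_le_eq mult.commute)
  qed
  then show "quot_norm (coset D (c *\<^sub>R x)) \<le> c * quot_norm (coset D x)"
    using c by (simp add: divide_le_eq mult.commute)
qed

text \<open>A linear functional dominated by the quotient norm automatically annihilates \<open>D\<close> and is
  bounded by the norm, so it suffices to support the quotient norm at \<open>x\<close>.\<close>

lemma norming_functional_of_quotient:
  fixes D :: "'a::real_normed_vector set"
  assumes D: "subspace D"
  obtains f :: "'a \<Rightarrow>\<^sub>L real"
  where "f \<in> annihilator D" "norm f \<le> 1" "f x = quot_norm (coset D x)"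
proof -
  obtain f where f: "linear f" and le: "\<And>y. f y \<le> quot_norm (coset D y)"
    and fx: "f x = quot_norm (coset D x)"
    using hahn_banach_support[OF sublinear_quot_norm[OF D], of x] by blast
  have neg: "f (- y) = - f y" for y by (rule linear_neg[OF f])
  have bound: "\<bar>f y\<bar> \<le> norm y" for y
    using le[of y] le[of "- y"] quot_norm_coset_le_norm[OF D, of y]
      quot_norm_coset_le_norm[OF D, of "- y"] neg[of y]
    by simp
  have "bounded_linear f"
    by (rule bounded_linear_intro[where K = 1])
      (use linear_add[OF f] linear_scale[OF f] bound in auto)
  then have F: "blinfun_apply (Blinfun f) = f" by (rule bounded_linear_Blinfun_apply)
  have "f d = 0" if "d \<in> D" for d
    using le[of d] le[of "- d"] neg[of d] quot_norm_coset_mem[OF D that]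
      quot_norm_coset_mem[OF D subspace_neg[OF D that]]
    by simp
  then have "Blinfun f \<in> annihilator D" by (simp add: annihilator_def F)
  moreover have "norm (Blinfun f) \<le> 1"
    by (rule norm_blinfun_bound) (simp_all add: F bound)
  ultimately show thesis using that F fx by simp
qed

section \<open>From a contractive projection to the embedding\<close>

lemma contractive_apply_le:
  assumes "norm P \<le> 1"
  shows "norm (blinfun_apply P f) \<le> norm f"
  using order_trans[OF norm_blinfun[of P f] mult_right_mono[OF assms norm_ge_zero]] by simp

text \<open>With \<open>annihilator D\<close> identified with the dual of the quotient, the embedding is the canonical
  map of the quotient into its bidual followed by the adjoint of \<open>P\<close>.\<close>

lemma quotient_embedding_of_contractive_projection:
  fixes D :: "'a::real_normed_vector set" and P :: "('a \<Rightarrow>\<^sub>L real) \<Rightarrow>\<^sub>L ('a \<Rightarrow>\<^sub>L real)"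
  assumes D: "subspace D"
    and P: "contractive_projection P"
    and ran: "range (blinfun_apply P) = annihilator D"
  shows "\<exists>J :: 'a set \<Rightarrow> (('a \<Rightarrow>\<^sub>L real) \<Rightarrow>\<^sub>L real). quot_linear_isometric_embedding D J"
proof -
  have "P o\<^sub>L P = P" and "norm P \<le> 1"
    using P by (simp_all add: contractive_projection_def)
  then have idem: "P (P f) = P f" for f
    by (metis blinfun_apply_blinfun_compose)
  have kill: "P f d = 0" if "d \<in> D" for f d
    using ran that by (auto simp: annihilator_def)
  have fix_ann: "P f = f" if "f \<in> annihilator D" for f
    using that idem unfolding ran[symmetric] by auto
  define J :: "'a set \<Rightarrow> (('a \<Rightarrow>\<^sub>L real) \<Rightarrow>\<^sub>L real)"
    where "J A = Blinfun (\<lambda>f. P f (SOME a. a \<in> A))" for A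
  have J: "J (coset D x) f = P f x" for x f
  proof -
    have "bounded_linear (\<lambda>f. P f (SOME a. a \<in> coset D x))"
      by (intro bounded_linear_compose[OF blinfun.bounded_linear_left blinfun.bounded_linear_right])
    then have "J (coset D x) f = P f (SOME a. a \<in> coset D x)"
      by (simp add: J_def bounded_linear_Blinfun_apply)
    moreover have "x \<in> coset D x" using subspace_0[OF D] by (force simp: coset_def)
    then have "(SOME a. a \<in> coset D x) \<in> coset D x" by (rule someI)
    then obtain d where "d \<in> D" "(SOME a. a \<in> coset D x) = x + d"
      by (auto simp: coset_def)
    ultimately show ?thesis by (simp add: blinfun.add_right kill)
  qed
  have norm_J: "norm (J (coset D x)) = quot_norm (coset D x)" for x
  proof (rule antisym)
    have "norm (J (coset D x)) \<le> norm (x + d)" if "d \<in> D" for d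
    proof (rule norm_blinfun_bound)
      fix f
      have "norm (J (coset D x) f) = norm (P f (x + d))"
        using that by (simp add: J blinfun.add_right kill)
      also have "\<dots> \<le> norm (P f) * norm (x + d)" by (rule norm_blinfun)
      also have "\<dots> \<le> norm f * norm (x + d)"
        by (intro mult_right_mono contractive_apply_le \<open>norm P \<le> 1\<close> norm_ge_zero)
      finally show "norm (J (coset D x) f) \<le> norm (x + d) * norm f" by (simp add: mult.commute)
    qed simp
    then show "norm (J (coset D x)) \<le> quot_norm (coset D x)"
      by (rule quot_norm_coset_ge[OF D])
    obtain f :: "'a \<Rightarrow>\<^sub>L real"
      where f: "f \<in> annihilator D" "norm f \<le> 1" "f x = quot_norm (coset D x)"
      using norming_functional_of_quotient[OF D] .
    have "quot_norm (coset D x) = J (coset D x) f"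
      by (simp add: J fix_ann f)
    also have "\<dots> \<le> norm (J (coset D x)) * norm f"
      using norm_blinfun[of "J (coset D x)" f] by simp
    also have "\<dots> \<le> norm (J (coset D x))"
      using f(2) by (simp add: mult_left_le)
    finally show "quot_norm (coset D x) \<le> norm (J (coset D x))" .
  qed
  have "quot_linear_isometric_embedding D J"
    unfolding quot_linear_isometric_embedding_def quot_space_def
    by (auto simp: quot_add_coset[OF D] quot_scale_coset[OF D] norm_J J
        blinfun.add_left blinfun.add_right blinfun.scaleR_left blinfun.scaleR_right
        intro!: blinfun_eqI)
  then show ?thesis by blast
qed

section \<open>Invariant functionals\<close>

lemma annihilator_closure_span:
  "annihilator (closure (span S)) = annihilator S"
proof
  show "annihilator (closure (span S)) \<subseteq> annihilator S"
    using span_superset[of S] closure_subset[of "span S"] by (auto simp: annihilator_def)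
  show "annihilator S \<subseteq> annihilator (closure (span S))"
  proof
    fix f :: "'a \<Rightarrow>\<^sub>L real"
    assume f: "f \<in> annihilator S"
    let ?K = "{x. blinfun_apply f x = 0}"
    have "subspace ?K"
      by (auto simp: subspace_def blinfun.add_right blinfun.scaleR_right blinfun.zero_right)
    then have "span S \<subseteq> ?K"
      by (intro span_minimal) (use f in \<open>auto simp: annihilator_def\<close>)
    moreover have "closed ?K"
      by (intro closed_Collect_eq continuous_intros)
    ultimately have "closure (span S) \<subseteq> ?K" by (rule closure_minimal)
    then show "f \<in> annihilator (closure (span S))" by (auto simp: annihilator_def)
  qed
qed

lemma annihilator_cobound_space:
  "annihilator (cobound_space G V) = {f. \<forall>g\<in>carrier G. adjoint_op (V g) f = f}"
proof -
  have "f \<in> annihilator (cobound_space G V) \<longleftrightarrow> (\<forall>g\<in>carrier G. \<forall>u. f (V g u) = f u)"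
    for f :: "'a \<Rightarrow>\<^sub>L real"
    unfolding cobound_space_def annihilator_closure_span
    by (fastforce simp: annihilator_def blinfun.diff_right)
  moreover have "adjoint_op (V g) f = f \<longleftrightarrow> (\<forall>u. f (V g u) = f u)" for g and f :: "'a \<Rightarrow>\<^sub>L real"
    by (auto simp: adjoint_op_def fun_eq_iff simp flip: blinfun_apply_inject)
  ultimately show ?thesis by auto
qed

section \<open>Averaging over the group\<close>

lemma mean_add:
  "is_mean G m \<Longrightarrow> f \<in> linfty G \<Longrightarrow> h \<in> linfty G \<Longrightarrow>
    m (\<lambda>x\<in>carrier G. f x + h x) = m f + m h"
  and mean_scale: "is_mean G m \<Longrightarrow> f \<in> linfty G \<Longrightarrow> m (\<lambda>x\<in>carrier G. c * f x) = c * m f"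
  and mean_le_norm: "is_mean G m \<Longrightarrow> f \<in> linfty G \<Longrightarrow> \<bar>m f\<bar> \<le> linfty_norm G f"
  and mean_one: "is_mean G m \<Longrightarrow> m (\<lambda>x\<in>carrier G. 1) = 1"
  by (auto simp: is_mean_def)

lemma linfty_restrictI:
  assumes "\<And>x. x \<in> carrier G \<Longrightarrow> \<bar>f x\<bar> \<le> B"
  shows "(\<lambda>x\<in>carrier G. f x) \<in> linfty G"
  using assms by (auto simp: linfty_def bounded_iff)

lemma linfty_norm_le:
  assumes "group G" "\<And>x. x \<in> carrier G \<Longrightarrow> \<bar>f x\<bar> \<le> B"
  shows "linfty_norm G f \<le> B"
  unfolding linfty_norm_def
  by (rule cSUP_least) (use assms group.is_monoid[OF assms(1)] monoid.one_closed in auto)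

lemma mean_const:
  assumes "is_mean G m"
  shows "m (\<lambda>x\<in>carrier G. c) = c"
proof -
  have "(\<lambda>x\<in>carrier G. 1) \<in> linfty G" by (rule linfty_restrictI[where B = 1]) simp
  from mean_scale[OF assms this, of c]
  have "m (\<lambda>x\<in>carrier G. c * (\<lambda>x\<in>carrier G. 1) x) = c"
    by (simp only: mean_one[OF assms] mult_1_right)
  moreover have "(\<lambda>x\<in>carrier G. c * (\<lambda>x\<in>carrier G. 1) x) = (\<lambda>x\<in>carrier G. c)"
    by (rule restrict_ext) simp
  ultimately show ?thesis by simp
qed

text \<open>The inverse in \<open>V (inv g)\<close> converts left invariance of the mean into invariance of the
  average: replacing \<open>x\<close> by \<open>V h x\<close> turns \<open>inv g\<close> into \<open>inv g \<otimes> h = inv (inv h \<otimes> g)\<close>.\<close>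

lemma invariant_contractive_projection:
  fixes G :: "('g, 'm) monoid_scheme"
    and V :: "'g \<Rightarrow> ('a::real_normed_vector \<Rightarrow>\<^sub>L 'a)"
  assumes G: "group G" and am: "amenable G" and V: "V \<in> hom G Isom_lin"
  obtains P :: "('a \<Rightarrow>\<^sub>L real) \<Rightarrow>\<^sub>L ('a \<Rightarrow>\<^sub>L real)"
  where "contractive_projection P"
    and "range (blinfun_apply P) = {f. \<forall>g\<in>carrier G. adjoint_op (V g) f = f}"
proof -
  interpret group G by (rule G)
  obtain m where m: "is_mean G m" and inv_m: "left_invariant G m"
    using am by (auto simp: amenable_def)
  have iso: "norm (V g x) = norm x" if "g \<in> carrier G" for g x
    using hom_in_carrier[OF V that] by (simp add: Isom_lin_def)
  have V_mult: "V (g \<otimes>\<^bsub>G\<^esub> h) x = V g (V h x)" if "g \<in> carrier G" "h \<in> carrier G" for g h x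
    using hom_mult[OF V that] by (simp add: Isom_lin_def)
  define orb :: "('a \<Rightarrow>\<^sub>L real) \<Rightarrow> 'a \<Rightarrow> 'g \<Rightarrow> real"
    where "orb f x = (\<lambda>g\<in>carrier G. f (V (inv\<^bsub>G\<^esub> g) x))" for f x
  have orb_bound: "\<bar>f (V (inv\<^bsub>G\<^esub> g) x)\<bar> \<le> norm f * norm x"
    if "g \<in> carrier G" for f :: "'a \<Rightarrow>\<^sub>L real" and g x
    using norm_blinfun[of f "V (inv\<^bsub>G\<^esub> g) x"] iso[OF inv_closed[OF that], of x] by simp
  have orb_linfty: "orb f x \<in> linfty G" for f x
    unfolding orb_def by (rule linfty_restrictI[OF orb_bound])
  have bound: "\<bar>m (orb f x)\<bar> \<le> norm f * norm x" for f x
    using mean_le_norm[OF m orb_linfty[of f x]]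
      linfty_norm_le[OF G, of "orb f x" "norm f * norm x"] orb_bound[of _ f x]
    by (simp add: orb_def)
  have add: "m (orb (f + f') x) = m (orb f x) + m (orb f' x)"
    and add': "m (orb f (x + x')) = m (orb f x) + m (orb f x')" for f f' x x'
    unfolding mean_add[OF m orb_linfty orb_linfty, symmetric]
    by (auto simp: orb_def blinfun.add_left blinfun.add_right
        intro!: arg_cong[where f = m] restrict_ext)
  have scale: "m (orb (c *\<^sub>R f) x) = c * m (orb f x)"
    and scale': "m (orb f (c *\<^sub>R x)) = c * m (orb f x)" for c f x
    unfolding mean_scale[OF m orb_linfty, symmetric]
    by (auto simp: orb_def blinfun.scaleR_left blinfun.scaleR_right
        intro!: arg_cong[where f = m] restrict_ext)
  define Q where "Q f = Blinfun (\<lambda>x. m (orb f x))" for f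
  have Q: "Q f x = m (orb f x)" for f x
  proof -
    have "bounded_linear (\<lambda>x. m (orb f x))"
      by (rule bounded_linear_intro[where K = "norm f"])
        (use bound in \<open>simp_all add: add' scale' mult.commute\<close>)
    then show ?thesis by (simp add: Q_def bounded_linear_Blinfun_apply)
  qed
  have norm_Q: "norm (Q f) \<le> norm f" for f
    by (rule norm_blinfun_bound) (simp_all add: Q bound)
  have "bounded_linear Q"
    by (rule bounded_linear_intro[where K = 1])
      (auto simp: norm_Q Q add scale blinfun.add_left blinfun.scaleR_left intro!: blinfun_eqI)
  then have P: "blinfun_apply (Blinfun Q) = Q" by (rule bounded_linear_Blinfun_apply)
  let ?Inv = "{f. \<forall>g\<in>carrier G. adjoint_op (V g) f = f}"
  have Q_inv: "Q f \<in> ?Inv" for f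
  proof -
    have "Q f (V h x) = Q f x" if h: "h \<in> carrier G" for h x
    proof -
      have "orb f (V h x) g = orb f x (inv\<^bsub>G\<^esub> h \<otimes>\<^bsub>G\<^esub> g)" if g: "g \<in> carrier G" for g
        using g h by (simp add: orb_def inv_mult_group V_mult)
      then have "orb f (V h x) = (\<lambda>g\<in>carrier G. orb f x (inv\<^bsub>G\<^esub> h \<otimes>\<^bsub>G\<^esub> g))"
        by (intro extensionalityI[of _ "carrier G"]) (auto simp: orb_def)
      then show ?thesis
        using inv_m inv_closed[OF h] orb_linfty[of f x] by (simp add: Q left_invariant_def)
    qed
    then show ?thesis by (auto simp: adjoint_op_def intro!: blinfun_eqI)
  qed
  have Q_fix: "Q f = f" if "f \<in> ?Inv" for f
  proof (rule blinfun_eqI)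
    fix x
    have "f (V g x) = f x" if "g \<in> carrier G" for g
    proof -
      have "adjoint_op (V g) f = f" using \<open>f \<in> ?Inv\<close> that by blast
      then have "blinfun_apply (adjoint_op (V g) f) x = f x" by simp
      then show ?thesis by (simp add: adjoint_op_def)
    qed
    then have "orb f x = (\<lambda>g\<in>carrier G. f x)"
      unfolding orb_def by (intro restrict_ext) simp
    then show "Q f x = f x" by (simp add: Q mean_const[OF m])
  qed
  show thesis
  proof
    show "contractive_projection (Blinfun Q)"
      unfolding contractive_projection_def
    proof
      show "Blinfun Q o\<^sub>L Blinfun Q = Blinfun Q"
        by (rule blinfun_eqI) (simp only: blinfun_apply_blinfun_compose P Q_fix[OF Q_inv])
      show "norm (Blinfun Q) \<le> 1"
        by (rule norm_blinfun_bound) (simp_all add: P norm_Q)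
    qed
    show "range (blinfun_apply (Blinfun Q)) = ?Inv"
      unfolding P
    proof (intro subset_antisym subsetI)
      fix f
      assume "f \<in> ?Inv"
      from Q_fix[OF this] show "f \<in> range Q" by (rule range_eqI[OF sym])
    qed (use Q_inv in blast)
  qed
qed

theorem proposition3p9:
  fixes G :: "('g, 'm) monoid_scheme"
    and V :: "'g \<Rightarrow> ('a::banach \<Rightarrow>\<^sub>L 'a)"
  assumes "group G"
    and "amenable G"
    and "V \<in> hom G Isom_lin"
  shows "(\<exists>J :: 'a set \<Rightarrow> (('a \<Rightarrow>\<^sub>L real) \<Rightarrow>\<^sub>L real).
            quot_linear_isometric_embedding (cobound_space G V) J)
       \<and> annihilator (cobound_space G V)
            = {f :: 'a \<Rightarrow>\<^sub>L real. \<forall>g\<in>carrier G. adjoint_op (V g) f = f}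
       \<and> (\<exists>P :: ('a \<Rightarrow>\<^sub>L real) \<Rightarrow>\<^sub>L ('a \<Rightarrow>\<^sub>L real).
            contractive_projection P
            \<and> range (blinfun_apply P) = annihilator (cobound_space G V))"
proof -
  obtain P :: "('a \<Rightarrow>\<^sub>L real) \<Rightarrow>\<^sub>L ('a \<Rightarrow>\<^sub>L real)"
    where P: "contractive_projection P"
      and ran: "range (blinfun_apply P) = annihilator (cobound_space G V)"
    using invariant_contractive_projection[OF assms] unfolding annihilator_cobound_space .
  show ?thesis
    using P ran
    by (intro conjI exI[of _ P] annihilator_cobound_space
        quotient_embedding_of_contractive_projection[OF subspace_cobound_space P ran])
qed

end
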